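(* For any $m\in\mathbb{N}$, no overbidding is allowed among $m$-uniform safe strategies: that is, the class $\mathcal{P}_m$ of all $m$-uniform safe bidding strategies is exactly $$\mathcal{P}_m=\Big\{\mathbf{b}=\langle(b_1,q_1),\dots,(b_m,q_m)\rangle:\ b_\ell\le w_{Q_\ell}\ \text{for all } \ell\in[m]\Big\}.$$
   Context: A uniform price auction sells $K$ identical units. A fixed bidder has valuation vector $\mathbf v=(v_1,\dots,v_M)$ with $v_1\ge v_2\ge\dots\ge v_M>0$, where $M\le K$ is the bidder's maximum demand. Define $w_j=\frac1j\sum_{\ell\le j}v_\ell$ for $j\in[M]$. An $m$-uniform bidding strategy is $\mathbf b=\langle(b_1,q_1),\dots,(b_m,q_m)\rangle$ with $b_1>b_2>\dots>b_m>0$, positive integers $q_j$, $Q_j=\sum_{\ell\le j}q_\ell$ ($Q_0=0$) and $Q_m\le M$; it stands for the bid vector consisting of $q_1$ copies of $b_1$, then $q_2$ copies of $b_2$, and so on. Given the competing bids $\boldsymbol\beta_-$ (the multiset of bids of all other bidders), all bids are sorted in non-increasing order and the $K$ highest bids each win one unit (ties broken in favor of the bidder); the bidder's allocation $x$ is the number of its winning bids, the per-unit price $p$ is the $K$-th highest submitted bid, and the bidder's value and payment are $V(\mathbf b;\boldsymbol\beta_-)=\sum_{j\le x}v_j$ and $P(\mathbf b;\boldsymbol\beta_-)=p\cdot x$ (both $0$ if $x=0$). The strategy is RoI feasible for $\boldsymbol\beta_-$ if $V(\mathbf b;\boldsymbol\beta_-)\ge P(\mathbf b;\boldsymbol\beta_-)$,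 and it is called safe if it is RoI feasible for every possible $\boldsymbol\beta_-$. A strategy is overbidding if $b_\ell>w_{Q_\ell}$ for some $\ell$. *)

theory Defs
  imports Complex_Main "HOL-Library.Multiset" "HOL-Library.Product_Lexorder"
begin

text \<open>Valuations are functions on 1-based positions \<open>1, \<dots>, M\<close>; values elsewhere are irrelevant.\<close>

definition valuation :: "nat \<Rightarrow> (nat \<Rightarrow> real) \<Rightarrow> bool" where
  "valuation M v \<longleftrightarrow> 1 \<le> M \<and> (\<forall>i\<in>{1..M}. \<forall>j\<in>{1..M}. i \<le> j \<longrightarrow> v j \<le> v i) \<and> v M > 0"

definition avg_value :: "(nat \<Rightarrow> real) \<Rightarrow> nat \<Rightarrow> real" where
  "avg_value v j = (1 / real j) * (\<Sum>l=1..j. v l)"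

type_synonym strategy = "(real \<times> nat) list"

text \<open>List positions are 0-based, so the pair \<open>(b\<^sub>l, q\<^sub>l)\<close> sits at position \<open>l - 1\<close>.\<close>

definition bid_value :: "strategy \<Rightarrow> nat \<Rightarrow> real" where
  "bid_value s l = fst (s ! (l - 1))"

definition quantity :: "strategy \<Rightarrow> nat \<Rightarrow> nat" where
  "quantity s l = snd (s ! (l - 1))"

definition cum_quantity :: "strategy \<Rightarrow> nat \<Rightarrow> nat" where
  "cum_quantity s j = (\<Sum>l=1..j. quantity s l)"

definition uniform_strategy :: "nat \<Rightarrow> nat \<Rightarrow> strategy \<Rightarrow> bool" where
  "uniform_strategy M m s \<longleftrightarrow>
     length s = m \<and>
     (\<forall>l\<in>{1..m}. bid_value s l > 0 \<and> quantity s l > 0) \<and>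
     (\<forall>k\<in>{1..m}. \<forall>l\<in>{1..m}. k < l \<longrightarrow> bid_value s k > bid_value s l) \<and>
     cum_quantity s m \<le> M"

definition bid_vector :: "strategy \<Rightarrow> real list" where
  "bid_vector s = concat (map (\<lambda>(b, q). replicate q b) s)"

text \<open>
  Every submitted bid carries a flag telling whether it belongs to the fixed bidder.  The
  order on pairs is lexicographic with \<open>False < True\<close>, so in the non-increasing ranking the
  bidder's own bids precede equal competing bids: ties are broken in favor of the bidder.
\<close>

definition ranking :: "strategy \<Rightarrow> real multiset \<Rightarrow> (real \<times> bool) list" where
  "ranking s \<beta> =
     rev (sorted_list_of_multiset
       (image_mset (\<lambda>b. (b, True)) (mset (bid_vector s)) + image_mset (\<lambda>c. (c, False)) \<beta>))"

definition allocation :: "nat \<Rightarrow> strategy \<Rightarrow> real multiset \<Rightarrow> nat" where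
  "allocation K s \<beta> = length (filter snd (take K (ranking s \<beta>)))"

text \<open>If fewer than \<open>K\<close> bids are submitted, the missing bids count as zero bids.\<close>

definition price :: "nat \<Rightarrow> strategy \<Rightarrow> real multiset \<Rightarrow> real" where
  "price K s \<beta> =
     (if K \<le> length (ranking s \<beta>) then fst (ranking s \<beta> ! (K - 1)) else 0)"

definition total_value :: "nat \<Rightarrow> (nat \<Rightarrow> real) \<Rightarrow> strategy \<Rightarrow> real multiset \<Rightarrow> real" where
  "total_value K v s \<beta> = (\<Sum>j=1..allocation K s \<beta>. v j)"

definition payment :: "nat \<Rightarrow> strategy \<Rightarrow> real multiset \<Rightarrow> real" where
  "payment K s \<beta> = price K s \<beta> * real (allocation K s \<beta>)"

definition roi_feasible :: "nat \<Rightarrow> (nat \<Rightarrow> real) \<Rightarrow> strategy \<Rightarrow> real multiset \<Rightarrow> bool" where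
  "roi_feasible K v s \<beta> \<longleftrightarrow> total_value K v s \<beta> \<ge> payment K s \<beta>"

text \<open>The competing bids form an arbitrary finite multiset of nonnegative reals, of any size.\<close>

definition safe :: "nat \<Rightarrow> (nat \<Rightarrow> real) \<Rightarrow> strategy \<Rightarrow> bool" where
  "safe K v s \<longleftrightarrow> (\<forall>\<beta>. (\<forall>c\<in>#\<beta>. c \<ge> 0) \<longrightarrow> roi_feasible K v s \<beta>)"

definition overbidding :: "(nat \<Rightarrow> real) \<Rightarrow> strategy \<Rightarrow> bool" where
  "overbidding v s \<longleftrightarrow>
     (\<exists>l\<in>{1..length s}. bid_value s l > avg_value v (cum_quantity s l))"

definition safe_strategies :: "nat \<Rightarrow> nat \<Rightarrow> (nat \<Rightarrow> real) \<Rightarrow> nat \<Rightarrow> strategy set" where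
  "safe_strategies K M v m = {s. uniform_strategy M m s \<and> safe K v s}"

end

theory Submission
  imports Defs
begin

text \<open>
  An overbid \<open>b\<^sub>l > w\<^bsub>Q\<^sub>l\<^esub>\<close> is exposed by \<open>K - Q\<^sub>l\<close> competing bids above all own bids: the bidder
  then wins exactly \<open>Q\<^sub>l\<close> units at price \<open>b\<^sub>l\<close>.  Conversely, if the bidder wins \<open>x\<close> units at price
  \<open>p\<close> and \<open>l\<close> is the last index with \<open>p \<le> b\<^sub>l\<close>, then \<open>x \<le> Q\<^sub>l\<close>, and the averages \<open>w\<close> are
  non-increasing, so \<open>p \<le> b\<^sub>l \<le> w\<^bsub>Q\<^sub>l\<^esub> \<le> w\<^sub>x\<close>.
\<close>

section \<open>Bid vectors and their blocks of equal bids\<close>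

lemma cum_quantity_eq_sum_list:
  assumes "l \<le> length s"
  shows "cum_quantity s l = sum_list (map snd (take l s))"
  using assms
proof (induction l)
  case 0
  then show ?case by (simp add: cum_quantity_def)
next
  case (Suc l)
  then show ?case
    by (simp add: cum_quantity_def quantity_def take_Suc_conv_app_nth)
qed

lemma length_bid_vector: "length (bid_vector s) = sum_list (map snd s)"
  by (induction s) (auto simp: bid_vector_def)

lemma length_bid_vector_take:
  "l \<le> length s \<Longrightarrow> length (bid_vector (take l s)) = cum_quantity s l"
  by (simp add: length_bid_vector cum_quantity_eq_sum_list)

lemma bid_vector_append: "bid_vector (s @ t) = bid_vector s @ bid_vector t"
  by (simp add: bid_vector_def)

lemma filter_bid_vector:
  "filter P (bid_vector s) = bid_vector (filter (\<lambda>x. P (fst x)) s)"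
  by (induction s) (auto simp: bid_vector_def)

lemma set_bid_vector_subset: "set (bid_vector s) \<subseteq> fst ` set s"
  by (force simp: bid_vector_def)

lemma sorted_wrt_bid_vector:
  assumes "sorted_wrt (\<lambda>x y. fst x > fst y) s"
  shows "sorted_wrt (\<ge>) (bid_vector s)"
  using assms
proof (induction s)
  case Nil
  then show ?case by (simp add: bid_vector_def)
next
  case (Cons a s)
  have "bid_vector (a # s) = replicate (snd a) (fst a) @ bid_vector s"
    by (simp add: bid_vector_def split: prod.split)
  moreover have "sorted_wrt (\<ge>) (replicate (snd a) (fst a))"
    by (simp add: sorted_wrt_iff_nth_less)
  ultimately show ?case
    using Cons set_bid_vector_subset[of s] by (force simp: sorted_wrt_append)
qed

lemma uniform_strategy_sorted:
  assumes "uniform_strategy M m s"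
  shows "sorted_wrt (\<lambda>x y. fst x > fst y) s"
  unfolding sorted_wrt_iff_nth_less
proof (intro allI impI)
  fix i j assume "i < j" "j < length s"
  then have "bid_value s (Suc i) > bid_value s (Suc j)"
    using assms by (simp add: uniform_strategy_def)
  then show "fst (s ! i) > fst (s ! j)" by (simp add: bid_value_def)
qed

lemma cum_quantity_mono: "i \<le> j \<Longrightarrow> cum_quantity s i \<le> cum_quantity s j"
  unfolding cum_quantity_def by (intro sum_mono2) auto

lemma cum_quantity_le:
  assumes "uniform_strategy M m s" "l \<le> m"
  shows "cum_quantity s l \<le> M"
  using cum_quantity_mono[OF assms(2), of s] assms(1) by (simp add: uniform_strategy_def)

lemma length_bid_vector_le:
  assumes "uniform_strategy M m s"
  shows "length (bid_vector s) \<le> M"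
  using assms length_bid_vector_take[of "length s" s] by (simp add: uniform_strategy_def)

text \<open>Positions count from 0, so this entry is the lowest winning bid of a bidder who wins
  exactly \<open>cum_quantity s l\<close> units; it becomes the price in the scenario that exposes
  an overbid.\<close>

lemma last_bid_of_block:
  assumes "uniform_strategy M m s" "l \<in> {1..m}"
  shows "cum_quantity s l > 0" "bid_vector s ! (cum_quantity s l - 1) = bid_value s l"
proof -
  obtain k where k: "l = Suc k" "k < length s"
    using assms by (cases l) (auto simp: uniform_strategy_def)
  obtain b q where bq: "s ! k = (b, q)" by fastforce
  have "quantity s l > 0" using assms by (simp add: uniform_strategy_def)
  then have q: "q > 0" using k bq by (simp add: quantity_def)
  have Q: "length (bid_vector (take l s)) = cum_quantity s l"
    using k by (intro length_bid_vector_take) simp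
  have "bid_vector (take l s) = bid_vector (take k s) @ replicate q b"
    using k bq by (simp add: take_Suc_conv_app_nth bid_vector_append) (simp add: bid_vector_def)
  then have ne: "bid_vector (take l s) \<noteq> []" and last: "last (bid_vector (take l s)) = b"
    using q by auto
  show pos: "cum_quantity s l > 0" using ne Q by (metis length_greater_0_conv)
  have "bid_vector s = bid_vector (take l s) @ bid_vector (drop l s)"
    by (simp flip: bid_vector_append)
  then have "bid_vector s ! (cum_quantity s l - 1) = bid_vector (take l s) ! (cum_quantity s l - 1)"
    using pos Q by (simp add: nth_append)
  also have "\<dots> = b" using last ne Q by (simp add: last_conv_nth)
  finally show "bid_vector s ! (cum_quantity s l - 1) = bid_value s l"
    using k bq by (simp add: bid_value_def)
qed

section \<open>The ranking of all submitted bids\<close>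

lemma mset_ranking:
  "mset (ranking s \<beta>) =
     image_mset (\<lambda>b. (b, True)) (mset (bid_vector s)) + image_mset (\<lambda>c. (c, False)) \<beta>"
  by (simp add: ranking_def)

lemma sorted_wrt_ranking: "sorted_wrt (\<ge>) (ranking s \<beta>)"
  by (simp add: ranking_def sorted_wrt_rev)

text \<open>A non-increasing list is determined by its multiset, so a ranking can be exhibited
  instead of computed by sorting.\<close>

lemma ranking_eqI:
  assumes "mset r = image_mset (\<lambda>b. (b, True)) (mset (bid_vector s)) + image_mset (\<lambda>c. (c, False)) \<beta>"
    and "sorted_wrt (\<ge>) r"
  shows "ranking s \<beta> = r"
proof -
  have "sort r = rev r"
    using assms(2) by (intro properties_for_sort) (simp_all add: sorted_wrt_rev)
  then show ?thesis
    unfolding ranking_def assms(1)[symmetric] by simp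
qed

lemma ranking_high_competition:
  assumes "uniform_strategy M m s" and "\<And>b. b \<in> set (bid_vector s) \<Longrightarrow> b < B"
  shows "ranking s (replicate_mset n B) =
           replicate n (B, False) @ map (\<lambda>b. (b, True)) (bid_vector s)"
proof (rule ranking_eqI)
  have "sorted_wrt (\<ge>) (replicate n (B, False))"
    by (simp add: sorted_wrt_iff_nth_less)
  moreover have "sorted_wrt (\<ge>) (map (\<lambda>b. (b, True)) (bid_vector s))"
    using sorted_wrt_bid_vector[OF uniform_strategy_sorted[OF assms(1)]]
    by (auto simp: sorted_wrt_map elim!: sorted_wrt_mono_rel[rotated])
  ultimately show "sorted_wrt (\<ge>) (replicate n (B, False) @ map (\<lambda>b. (b, True)) (bid_vector s))"
    using assms(2) by (auto simp: sorted_wrt_append)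
qed simp

section \<open>Necessity: safe strategies do not overbid\<close>

lemma safe_imp_bid_le_avg_value:
  assumes s: "uniform_strategy M m s" and "M \<le> K" and safe: "safe K v s" and l: "l \<in> {1..m}"
  shows "bid_value s l \<le> avg_value v (cum_quantity s l)"
proof -
  define Q where "Q = cum_quantity s l"
  \<comment> \<open>Inserting 0 keeps \<open>Max\<close> defined when there are no own bids and
    makes \<open>B\<close> positive, hence an admissible competing bid; adding 1 puts it strictly
    above all own bids, so no tie arises.\<close>
  define B where "B = Max (insert 0 (set (bid_vector s))) + 1"
  have B: "b < B" if "b \<in> insert 0 (set (bid_vector s))" for b
    unfolding B_def using that
    by (meson List.finite_set Max_ge finite_insert less_add_one order_le_less_trans)
  have Q: "0 < Q" "Q \<le> K"
    using last_bid_of_block(1)[OF s l] cum_quantity_le[OF s, of l] l \<open>M \<le> K\<close> by (auto simp: Q_def)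
  have Qlen: "Q \<le> length (bid_vector s)"
    using cum_quantity_mono[of l m s] length_bid_vector_take[of "length s" s] s l
    by (simp add: uniform_strategy_def Q_def)
  define \<beta> where "\<beta> = replicate_mset (K - Q) B"
  have r: "ranking s \<beta> = replicate (K - Q) (B, False) @ map (\<lambda>b. (b, True)) (bid_vector s)"
    unfolding \<beta>_def using B by (intro ranking_high_competition[OF s]) auto
  have "allocation K s \<beta> = Q"
    using Q Qlen by (simp add: allocation_def r take_map filter_map o_def)
  moreover have "price K s \<beta> = bid_value s l"
  proof -
    \<comment> \<open>The \<open>K\<close>-th ranked bid lies behind the \<open>K - Q\<close> copies
      of \<open>B\<close>, at index \<open>Q - 1\<close> of the own bids; \<open>Q > 0\<close> keeps
      the truncated subtraction exact.\<close>
    have "K - 1 - (K - Q) = Q - 1" "\<not> K - 1 < K - Q" using Q by auto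
    then have "fst (ranking s \<beta> ! (K - 1)) = bid_vector s ! (Q - 1)"
      using Q Qlen by (simp add: r nth_append)
    moreover have "K \<le> length (ranking s \<beta>)" using Q Qlen by (simp add: r)
    ultimately show ?thesis
      using last_bid_of_block(2)[OF s l] by (simp add: price_def Q_def)
  qed
  moreover have "roi_feasible K v s \<beta>"
    using safe B[of 0] unfolding safe_def by (fastforce simp: \<beta>_def)
  ultimately have "bid_value s l * real Q \<le> (\<Sum>j=1..Q. v j)"
    by (simp add: roi_feasible_def total_value_def payment_def)
  then show ?thesis
    using Q by (simp add: avg_value_def field_simps flip: Q_def)
qed

section \<open>Averages of non-increasing valuations\<close>

lemma valuation_pos:
  assumes "valuation M v" "j \<in> {1..M}"
  shows "v j > 0"
proof -
  have "v M \<le> v j" "v M > 0" using assms by (auto simp: valuation_def)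
  then show ?thesis by simp
qed

text \<open>Each value after position \<open>x\<close> is at most \<open>v x\<close>, which in turn
  is at most the average of the first \<open>x\<close> values; including such terms cannot raise the
  average.\<close>

lemma avg_value_antimono:
  assumes v: "valuation M v" and "1 \<le> x" "x \<le> n" "n \<le> M"
  shows "avg_value v n \<le> avg_value v x"
proof -
  have split: "(\<Sum>j=1..n. v j) = (\<Sum>j=1..x. v j) + (\<Sum>j=x+1..n. v j)"
    using sum.ub_add_nat[of 1 x v "n - x"] assms by simp
  have "(\<Sum>j=x+1..n. v j) \<le> of_nat (card {x+1..n}) * v x"
    using assms by (intro sum_bounded_above) (auto simp: valuation_def)
  then have upper: "(\<Sum>j=x+1..n. v j) \<le> (real n - real x) * v x"
    using assms by (simp add: of_nat_diff)
  have "of_nat (card {1..x}) * v x \<le> (\<Sum>j=1..x. v j)"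
    using assms by (intro sum_bounded_below) (auto simp: valuation_def)
  then have lower: "real x * v x \<le> (\<Sum>j=1..x. v j)" by simp
  have "real x * (\<Sum>j=x+1..n. v j) \<le> real x * ((real n - real x) * v x)"
    using upper by (intro mult_left_mono) auto
  also have "\<dots> = (real n - real x) * (real x * v x)" by simp
  also have "\<dots> \<le> (real n - real x) * (\<Sum>j=1..x. v j)"
    using lower assms by (intro mult_left_mono) auto
  \<comment> \<open>Adding \<open>x\<close> times the sum of the first \<open>x\<close> values to
    both sides gives the comparison of averages with denominators cleared.\<close>
  finally have "real x * (\<Sum>j=1..n. v j) \<le> real n * (\<Sum>j=1..x. v j)"
    unfolding split by (simp add: algebra_simps)
  then show ?thesis
    using assms by (simp add: avg_value_def field_simps)
qed

section \<open>Bounds relating allocation, price and own bids\<close>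

lemma allocation_le_length: "allocation K s \<beta> \<le> length (bid_vector s)"
proof -
  have "allocation K s \<beta> \<le> length (filter snd (take K (ranking s \<beta>) @ drop K (ranking s \<beta>)))"
    unfolding allocation_def filter_append by simp
  also have "\<dots> = size (filter_mset snd (mset (ranking s \<beta>)))"
    by (simp flip: mset_filter)
  also have "\<dots> = length (bid_vector s)"
    by (simp add: mset_ranking filter_mset_image_mset)
  finally show ?thesis .
qed

lemma price_le_winning_bids:
  assumes "1 \<le> K" "K \<le> length (ranking s \<beta>)" "x \<in> set (take K (ranking s \<beta>))"
  shows "price K s \<beta> \<le> fst x"
proof -
  obtain i where i: "i < K" "i < length (ranking s \<beta>)" "x = ranking s \<beta> ! i"
    using assms by (auto simp: in_set_conv_nth)
  have "ranking s \<beta> ! (K - 1) \<le> x"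
  proof (cases "i = K - 1")
    case False
    then show ?thesis
      using i assms sorted_wrt_nth_less[OF sorted_wrt_ranking, of i "K - 1" s \<beta>] by auto
  qed (simp add: i)
  \<comment> \<open>In the lexicographic order the flag only breaks ties, so the order passes to the
    bids themselves.\<close>
  then show ?thesis using assms by (auto simp: price_def less_eq_prod_def)
qed

text \<open>The price is the lowest winning bid, so own winning bids survive the filter; dropping
  the cutoff at \<open>K\<close> can only add entries, and the flag then singles out the own bids in
  the multiset.\<close>

lemma allocation_le_bids_above_price:
  assumes "1 \<le> K" "K \<le> length (ranking s \<beta>)"
  shows "allocation K s \<beta> \<le> length (filter (\<lambda>b. price K s \<beta> \<le> b) (bid_vector s))"
proof -
  let ?p = "price K s \<beta>" and ?r = "ranking s \<beta>"
  let ?P = "\<lambda>x. snd x \<and> ?p \<le> fst x"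
  have "filter snd (take K ?r) = filter ?P (take K ?r)"
    using price_le_winning_bids[OF assms] by (intro filter_cong) auto
  then have "allocation K s \<beta> \<le> length (filter ?P (take K ?r @ drop K ?r))"
    unfolding allocation_def filter_append by simp
  also have "\<dots> = size (filter_mset ?P (mset ?r))"
    by (simp flip: mset_filter)
  also have "\<dots> = length (filter (\<lambda>b. ?p \<le> b) (bid_vector s))"
    by (simp add: mset_ranking filter_mset_image_mset flip: mset_filter)
  finally show ?thesis .
qed

text \<open>In a decreasing list, everything after the first bid below \<open>p\<close> is also
  below \<open>p\<close>. The length \<open>l\<close> of the prefix is the index of the last block
  that can win at price \<open>p\<close>.\<close>

lemma filter_above_eq_take:
  fixes s :: "('a::linorder \<times> 'b) list"
  assumes "sorted_wrt (\<lambda>x y. fst x > fst y) s"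
  obtains l where "l \<le> length s" "filter (\<lambda>x. p \<le> fst x) s = take l s"
    "\<And>i. i < l \<Longrightarrow> p \<le> fst (s ! i)"
proof -
  let ?t = "takeWhile (\<lambda>x. p \<le> fst x) s"
  have "filter (\<lambda>x. p \<le> fst x) s = ?t"
    using assms
  proof (induction s)
    case (Cons a s)
    have "filter (\<lambda>x. p \<le> fst x) s = []" if "\<not> p \<le> fst a"
      using Cons.prems that by (auto simp: filter_empty_conv)
    with Cons show ?case by auto
  qed simp
  moreover have "?t = take (length ?t) s" by (rule takeWhile_eq_take)
  ultimately show ?thesis
    using that[of "length ?t"]
    by (metis length_takeWhile_le nth_mem set_takeWhileD takeWhile_nth)
qed

section \<open>Sufficiency: strategies without overbidding are safe\<close>

lemma safe_if_bids_le_avg_value: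
  assumes v: "valuation M v" and "M \<le> K" and s: "uniform_strategy M m s"
    and le: "\<And>l. l \<in> {1..m} \<Longrightarrow> bid_value s l \<le> avg_value v (cum_quantity s l)"
  shows "safe K v s"
  unfolding safe_def roi_feasible_def
proof (intro allI impI)
  fix \<beta>
  define x where "x = allocation K s \<beta>"
  define p where "p = price K s \<beta>"
  have len: "length s = m" using s by (simp add: uniform_strategy_def)
  have K: "1 \<le> K" using v \<open>M \<le> K\<close> by (simp add: valuation_def)
  have xM: "x \<le> M"
    using allocation_le_length[of K s \<beta>] length_bid_vector_le[OF s] by (simp add: x_def)
  have "p * real x \<le> (\<Sum>j=1..x. v j)"
  proof (cases "x = 0 \<or> length (ranking s \<beta>) < K")
    \<comment> \<open>The payment vanishes: either nothing is won, or fewer than \<open>K\<close>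
      bids make the price 0 by convention.\<close>
    case True
    have "0 \<le> (\<Sum>j=1..x. v j)"
      using valuation_pos[OF v] xM by (intro sum_nonneg) (auto intro: less_imp_le)
    then show ?thesis using True by (auto simp: p_def price_def)
  next
    case False
    obtain l where l: "l \<le> length s" "filter (\<lambda>y. p \<le> fst y) s = take l s"
      "\<And>i. i < l \<Longrightarrow> p \<le> fst (s ! i)"
      using filter_above_eq_take[OF uniform_strategy_sorted[OF s]] by blast
    \<comment> \<open>Filtering the bid vector by \<open>p\<close> amounts to filtering whole
      blocks, which leaves the first \<open>l\<close> blocks.\<close>
    have xQ: "x \<le> cum_quantity s l"
      using allocation_le_bids_above_price[OF K, of s \<beta>] False l length_bid_vector_take[OF l(1)]
      by (simp add: x_def p_def filter_bid_vector)
    \<comment> \<open>\<open>l = 0\<close> would force \<open>x = 0\<close>, as the empty prefix has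
      quantity 0.\<close>
    then have lm: "l \<in> {1..m}"
      using False l len by (cases l) (auto simp: cum_quantity_def)
    have "p \<le> bid_value s l" using l(3)[of "l - 1"] lm by (simp add: bid_value_def)
    also have "\<dots> \<le> avg_value v (cum_quantity s l)" by (rule le[OF lm])
    also have "\<dots> \<le> avg_value v x"
      using False xQ cum_quantity_le[OF s, of l] lm by (intro avg_value_antimono[OF v]) auto
    finally show ?thesis using False by (simp add: avg_value_def field_simps)
  qed
  then show "payment K s \<beta> \<le> total_value K v s \<beta>"
    by (simp add: payment_def total_value_def x_def p_def)
qed

theorem mainTheorem1:
  fixes K M m :: nat and v :: "nat \<Rightarrow> real"
  assumes "valuation M v" and "M \<le> K"
  shows "(\<forall>s\<in>safe_strategies K M v m. \<not> overbidding v s) \<and>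
         safe_strategies K M v m =
           {s. uniform_strategy M m s \<and>
               (\<forall>l\<in>{1..m}. bid_value s l \<le> avg_value v (cum_quantity s l))}"
proof -
  have eq: "safe_strategies K M v m =
      {s. uniform_strategy M m s \<and>
          (\<forall>l\<in>{1..m}. bid_value s l \<le> avg_value v (cum_quantity s l))}"
    unfolding safe_strategies_def
    using safe_imp_bid_le_avg_value[OF _ assms(2)] safe_if_bids_le_avg_value[OF assms] by blast
  then show ?thesis
    by (auto simp: overbidding_def uniform_strategy_def not_less)
qed

end
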